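(* Let $\pi_t$ and $\hat\pi_t$ be the true and reference state densities on $\mathcal{X}=\mathbb{R}^n$, satisfying the Fokker-Planck equations with drifts $\boldsymbol{\phi}_t$ and $\hat{\boldsymbol{f}}_t$ respectively and with the same constant diffusion matrix $D=GQG^\top$ (symmetric positive definite): $$\frac{\partial\pi_t}{\partial t}=-\nabla_{\boldsymbol{x}}\cdot(\pi_t\boldsymbol{\phi}_t)+\frac12\nabla_{\boldsymbol{x}}\cdot(D\nabla_{\boldsymbol{x}}\pi_t),\qquad \frac{\partial\hat\pi_t}{\partial t}=-\nabla_{\boldsymbol{x}}\cdot(\hat\pi_t\hat{\boldsymbol{f}}_t)+\frac12\nabla_{\boldsymbol{x}}\cdot(D\nabla_{\boldsymbol{x}}\hat\pi_t).$$ Assume the regularity conventions listed in the context. Let $g_t=\|D^{-1/2}(\boldsymbol{\phi}_t-\hat{\boldsymbol{f}}_t)\|_2^2$ and suppose that $\underline{g_t}\le g_t\le\overline{g_t}$ for finite real numbers $\underline{g_t},\overline{g_t}$ (for each $t$, uniformly in the state). Then $$\frac{d}{dt}R(\pi_t\|\hat\pi_t)\;\le\;\frac12\left(\mathbb{E}_{\hat\pi_t}[g_t]+\frac{\overline{g_t}-\underline{g_t}}{\sqrt2}\sqrt{R(\pi_t\|\hat\pi_t)}\right).$$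
   Context: Relative entropy: $R(\pi_t\|\hat\pi_t)=\int_{\mathcal{X}}\pi_t\ln(\pi_t/\hat\pi_t)\,d\boldsymbol{x}$; $\mathbb{E}_{\hat\pi_t}$ is expectation with respect to the density $\hat\pi_t$. Model: the true state $\boldsymbol{x}_t=[\boldsymbol{r}_t^\top,\boldsymbol{v}_t^\top]^\top$ (position and velocity) follows $d\boldsymbol{x}_t=\boldsymbol{\phi}_t(\boldsymbol{x}_t,\boldsymbol{u}_t)dt+G\,d\boldsymbol{w}_t$ with $\boldsymbol{\phi}_t(\boldsymbol{x},\boldsymbol{u}_t)=\begin{bmatrix}\boldsymbol{v}\\-\nabla_{\boldsymbol{r}}U(\boldsymbol{r};\boldsymbol{\theta})\end{bmatrix}+B\boldsymbol{u}_t$, where $U$ is a scalar potential with parameters $\boldsymbol{\theta}$, $\boldsymbol{u}_t$ is the control, $B$ and $G$ are constant matrices, and $d\boldsymbol{w}_t$ has covariance $Q\,dt$. The reference state follows the same equation with $\boldsymbol{\phi}_t$ replaced by the affine drift $\hat{\boldsymbol{f}}_t(\boldsymbol{x},\boldsymbol{u}_t)=A_t\boldsymbol{x}+B\boldsymbol{u}_t+\boldsymbol{c}_t$, where $A_t=\nabla_{\boldsymbol{x}}\boldsymbol{f}_t(\boldsymbol{\mu}_t,\boldsymbol{u}_t)$, $\boldsymbol{c}_t=\boldsymbol{f}_t(\boldsymbol{\mu}_t,\boldsymbol{u}_t)-A_t\boldsymbol{\mu}_t-B\boldsymbol{u}_t$, $\boldsymbol{\mu}_t$ is the mean of $\hat\pi_t$,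 and $\boldsymbol{f}_t$ is $\boldsymbol{\phi}_t$ with $\boldsymbol{\theta}$ replaced by an estimate $\hat{\boldsymbol{\theta}}$. The drifts in $g_t$ are evaluated at $(\boldsymbol{x},\boldsymbol{u}_t)$, so $g_t$ is a function of $\boldsymbol{x}$. Regularity conventions: $\pi_t$ and $\hat\pi_t$ are strictly positive and smooth enough for the Fokker-Planck equations to hold classically; $R(\pi_t\|\hat\pi_t)<\infty$; the time derivative of $R(\pi_t\|\hat\pi_t)$ may be taken under the integral sign (dominated convergence for $\pi_t\ln(\pi_t/\hat\pi_t)$), as may that of $\int_{\mathcal X}\pi_t\,d\boldsymbol{x}=1$; and the divergence theorem may be applied on $\mathbb{R}^n$ without boundary terms to integrate $\ln(\pi_t/\hat\pi_t)$ against the right-hand side of the first equation and $\pi_t/\hat\pi_t$ against the right-hand side of the second, all integrals involved being absolutely convergent. *)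

theory Defs
  imports "HOL-Analysis.Analysis"
begin

section \<open>Vector calculus on \<open>real ^ 'n\<close>\<close>

definition grad :: "(real ^ 'n \<Rightarrow> real) \<Rightarrow> real ^ 'n \<Rightarrow> real ^ 'n" where
  "grad f x = (\<chi> i. frechet_derivative f (at x) (axis i 1))"

definition divergence :: "(real ^ 'n \<Rightarrow> real ^ 'n) \<Rightarrow> real ^ 'n \<Rightarrow> real" where
  "divergence F x = trace (jacobian F (at x))"


section \<open>Positive definite matrices and their principal square root\<close>

definition pos_def :: "real ^ 'n ^ 'n \<Rightarrow> bool" where
  "pos_def M \<longleftrightarrow> transpose M = M \<and> (\<forall>x. x \<noteq> 0 \<longrightarrow> 0 < x \<bullet> (M *v x))"

definition pos_semidef :: "real ^ 'n ^ 'n \<Rightarrow> bool" where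
  "pos_semidef M \<longleftrightarrow> transpose M = M \<and> (\<forall>x. 0 \<le> x \<bullet> (M *v x))"

text \<open>Meant for positive definite \<open>M\<close>, where the square root exists and is unique.\<close>

definition mat_sqrt :: "real ^ 'n ^ 'n \<Rightarrow> real ^ 'n ^ 'n" where
  "mat_sqrt M = (THE S. pos_def S \<and> S ** S = M)"

definition mat_inv_sqrt :: "real ^ 'n ^ 'n \<Rightarrow> real ^ 'n ^ 'n" where
  "mat_inv_sqrt M = matrix_inv (mat_sqrt M)"


section \<open>Densities and relative entropy\<close>

definition pos_density :: "('a::euclidean_space \<Rightarrow> real) \<Rightarrow> bool" where
  "pos_density p \<longleftrightarrow> (\<forall>x. 0 < p x) \<and> has_bochner_integral lborel p 1"

abbreviation density_measure :: "('a::euclidean_space \<Rightarrow> real) \<Rightarrow> 'a measure" where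
  "density_measure p \<equiv> density lborel (\<lambda>x. ennreal (p x))"

definition rel_entropy :: "('a::euclidean_space \<Rightarrow> real) \<Rightarrow> ('a \<Rightarrow> real) \<Rightarrow> real" where
  "rel_entropy p q = (LINT x|lborel. p x * ln (p x / q x))"

text \<open>
  For densities \<open>p\<close>, \<open>q\<close> the negative part of \<open>p ln (p / q)\<close> is always integrable, so that
  the relative entropy is finite iff its integrand is integrable.
\<close>

definition finite_rel_entropy :: "('a::euclidean_space \<Rightarrow> real) \<Rightarrow> ('a \<Rightarrow> real) \<Rightarrow> bool" where
  "finite_rel_entropy p q \<longleftrightarrow> integrable lborel (\<lambda>x. p x * ln (p x / q x))"


section \<open>The model\<close>

text \<open>
  A state \<open>x = [r, v]\<close> is indexed by \<open>'d + 'd\<close>: the \<open>Inl\<close> components are the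
  position, the \<open>Inr\<close> components the velocity.
\<close>

definition position :: "real ^ ('d + 'd) \<Rightarrow> real ^ 'd" where
  "position x = (\<chi> i. x $ Inl i)"

definition velocity :: "real ^ ('d + 'd) \<Rightarrow> real ^ 'd" where
  "velocity x = (\<chi> i. x $ Inr i)"

definition stack :: "real ^ 'd \<Rightarrow> real ^ 'd \<Rightarrow> real ^ ('d + 'd)" where
  "stack a b = (\<chi> k. case k of Inl i \<Rightarrow> a $ i | Inr i \<Rightarrow> b $ i)"

definition drift ::
  "(real ^ 'd \<Rightarrow> 'th \<Rightarrow> real) \<Rightarrow> real ^ 'm ^ ('d + 'd) \<Rightarrow> 'th \<Rightarrow>
    real ^ ('d + 'd) \<Rightarrow> real ^ 'm \<Rightarrow> real ^ ('d + 'd)" where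
  "drift U B \<theta> x u = stack (velocity x) (- grad (\<lambda>r. U r \<theta>) (position x)) + B *v u"

definition affine_drift ::
  "(real ^ 'n \<Rightarrow> real ^ 'm \<Rightarrow> real ^ 'n) \<Rightarrow> real ^ 'm ^ 'n \<Rightarrow> real ^ 'n \<Rightarrow>
    real ^ 'n \<Rightarrow> real ^ 'm \<Rightarrow> real ^ 'n" where
  "affine_drift f B \<mu> x u =
    (let A = jacobian (\<lambda>y. f y u) (at \<mu>);
         c = f \<mu> u - A *v \<mu> - B *v u
     in A *v x + B *v u + c)"

text \<open>
  Classical solutions of the Fokker-Planck equation with drift \<open>b t x\<close> and diffusion matrix \<open>D\<close>
  on the set \<open>T\<close> of times.  The differentiability conditions make every derivative occurring in
  the equation exist.
\<close>

definition fokker_planck ::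
  "real set \<Rightarrow> (real \<Rightarrow> real ^ 'n \<Rightarrow> real ^ 'n) \<Rightarrow> real ^ 'n ^ 'n \<Rightarrow>
    (real \<Rightarrow> real ^ 'n \<Rightarrow> real) \<Rightarrow> bool" where
  "fokker_planck T b D p \<longleftrightarrow>
    (\<forall>t\<in>T. \<forall>x.
      p t differentiable (at x) \<and>
      grad (p t) differentiable (at x) \<and>
      (\<lambda>y. p t y *\<^sub>R b t y) differentiable (at x) \<and>
      ((\<lambda>s. p s x) has_real_derivative
        (- divergence (\<lambda>y. p t y *\<^sub>R b t y) x
         + 1 / 2 * divergence (\<lambda>y. D *v grad (p t) y) x)) (at t))"

text \<open>
  The right-hand side of the Fokker-Planck equation is the divergence of this vector field.
\<close>

definition fp_flux ::
  "(real ^ 'n \<Rightarrow> real ^ 'n) \<Rightarrow> real ^ 'n ^ 'n \<Rightarrow> (real ^ 'n \<Rightarrow> real) \<Rightarrow> real ^ 'n \<Rightarrow> real ^ 'n" where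
  "fp_flux b D p x = - (p x *\<^sub>R b x) + (1 / 2) *\<^sub>R (D *v grad p x)"


section \<open>Regularity conventions\<close>

definition diff_under_integral :: "(real \<Rightarrow> 'a::euclidean_space \<Rightarrow> real) \<Rightarrow> real \<Rightarrow> bool" where
  "diff_under_integral F t \<longleftrightarrow>
    integrable lborel (\<lambda>x. deriv (\<lambda>s. F s x) t) \<and>
    ((\<lambda>s. LINT x|lborel. F s x) has_real_derivative
      (LINT x|lborel. deriv (\<lambda>s. F s x) t)) (at t)"

text \<open>
  The divergence theorem on the whole space for \<open>h J\<close>, without boundary term; the integrals
  of both summands of \<open>div (h J) = h div J + grad h \<bullet> J\<close> converge absolutely.
\<close>

definition no_boundary_term ::
  "(real ^ 'n \<Rightarrow> real) \<Rightarrow> (real ^ 'n \<Rightarrow> real ^ 'n) \<Rightarrow> bool" where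
  "no_boundary_term h J \<longleftrightarrow>
    integrable lborel (\<lambda>x. h x * divergence J x) \<and>
    integrable lborel (\<lambda>x. grad h x \<bullet> J x) \<and>
    (LINT x|lborel. divergence (\<lambda>y. h y *\<^sub>R J y) x) = 0"

end

theory Submission
  imports Defs "HOL-Probability.Hoeffding"
begin

text \<open>
  Write \<open>p\<close> and \<open>q\<close> for the true and the reference density at time \<open>t\<close>, \<open>b\<close> for the difference of
  the two drifts and \<open>a\<close> for the gradient of \<open>ln (p / q)\<close>.  The theorem combines two
  independent estimates.

  First, differentiating the relative entropy under the integral sign, inserting the two
  Fokker-Planck equations and integrating by parts gives the entropy balance
  \<open>dR/dt = \<integral> p (a \<bullet> b - 1/2 a \<bullet> D a)\<close> (\<open>rel_entropy_has_derivative\<close>).  The common diffusion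
  matrix enters only through the negative quadratic form in \<open>a\<close>, so completing the square
  bounds the integrand by \<open>1/2 p g\<close>, where \<open>g\<close> is the square length of \<open>D\<^sup>-\<^sup>1\<^sup>/\<^sup>2 b\<close>
  (\<open>quadratic_bound_mat_inv_sqrt\<close>).  Hence \<open>dR/dt\<close> is at most half the mean of \<open>g\<close> under \<open>p\<close>.
  The matrix root is a definite description, and a spectral theorem for symmetric matrices
  shows that it denotes what it should.

  Second, the mean of a bounded function under \<open>p\<close> differs from its mean under \<open>q\<close> by at most
  its range times \<open>\<surd>(R / 2)\<close>, which is Pinsker's inequality
  (\<open>expectation_diff_le_rel_entropy\<close>).  It follows from the variational inequality for the
  relative entropy and Hoeffding's lemma.
\<close>


section \<open>Eigenbases of symmetric matrices and the positive definite square root\<close>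

text \<open>
  The eigenvector is a maximiser of the quadratic form \<open>x \<bullet> f x\<close> on the unit sphere of \<open>V\<close>, and
  the eigenvalue is the maximum.  Keeping \<open>V\<close> general lets the next proof apply this to the
  orthogonal complement of the eigenvectors already found.
\<close>

lemma self_adjoint_eigenvector_in_subspace:
  fixes f :: "'a::euclidean_space \<Rightarrow> 'a"
  assumes lin: "linear f" and sym: "\<And>x y. x \<bullet> f y = f x \<bullet> y"
    and V: "subspace V" "V \<noteq> {0}" and inv: "\<And>x. x \<in> V \<Longrightarrow> f x \<in> V"
  obtains e c where "e \<in> V" "norm e = 1" "f e = c *\<^sub>R e"
proof -
  let ?S = "sphere 0 1 \<inter> V"
  from V obtain w where w: "w \<in> V" "w \<noteq> 0"
    using subspace_0 by blast
  then have "w /\<^sub>R norm w \<in> ?S"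
    using V by (simp add: subspace_scale)
  then have "?S \<noteq> {}" by blast
  moreover have "compact ?S"
    using V by (intro compact_Int_closed closed_subspace) auto
  moreover have "continuous_on ?S (\<lambda>x. x \<bullet> f x)"
    using lin by (intro continuous_intros linear_continuous_on linear_conv_bounded_linear[THEN iffD1])
  ultimately obtain e where e: "e \<in> ?S" and emax: "\<And>y. y \<in> ?S \<Longrightarrow> y \<bullet> f y \<le> e \<bullet> f e"
    using continuous_attains_sup[of ?S "\<lambda>x. x \<bullet> f x"] by blast
  define c where "c = e \<bullet> f e"
  have e1: "e \<in> V" "norm e = 1" "e \<bullet> e = 1"
    using e by (auto simp: norm_eq_1)
  have quad: "y \<bullet> f y \<le> c * (y \<bullet> y)" if "y \<in> V" for y
  proof (cases "y = 0")
    case False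
    then have "y /\<^sub>R norm y \<in> ?S"
      using V that by (simp add: subspace_scale)
    from emax[OF this] have "(y \<bullet> f y) / (norm y)\<^sup>2 \<le> c"
      using linear_scale[OF lin] by (simp add: c_def power2_eq_square divide_simps)
    then show ?thesis
      using False by (simp add: divide_simps dot_square_norm)
  qed (simp add: linear_0[OF lin])
  define v where "v = f e - c *\<^sub>R e"
  have v: "v \<in> V"
    using V e1 inv by (simp add: v_def subspace_diff subspace_scale)
  have ev: "e \<bullet> v = 0"
    using e1 by (simp add: v_def c_def inner_diff_right)
  have vf: "v \<bullet> f e = v \<bullet> v" "e \<bullet> f v = v \<bullet> v"
  proof -
    have "v \<bullet> f e = v \<bullet> (v + c *\<^sub>R e)"
      by (simp add: v_def)
    also have "\<dots> = v \<bullet> v"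
      using ev by (simp add: inner_add_right inner_commute)
    finally show "v \<bullet> f e = v \<bullet> v" .
    then show "e \<bullet> f v = v \<bullet> v" by (simp only: sym[of e v] inner_commute[of "f e" v])
  qed
  \<comment> \<open>First variation at the maximiser: perturbing \<open>e\<close> by \<open>s v\<close> changes the form to first order
    by \<open>2 s (v \<bullet> v)\<close>, and its square length only to second order.\<close>
  have var: "2 * s * (v \<bullet> v) \<le> s\<^sup>2 * (c * (v \<bullet> v) - v \<bullet> f v)" for s :: real
  proof -
    have "(e + s *\<^sub>R v) \<bullet> f (e + s *\<^sub>R v) \<le> c * ((e + s *\<^sub>R v) \<bullet> (e + s *\<^sub>R v))"
      using V v e1 by (intro quad) (simp add: subspace_add subspace_scale)
    then show ?thesis
      using ev e1 vf
      by (simp add: linear_add[OF lin] linear_scale[OF lin] inner_add inner_commute[of v e]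
          c_def[symmetric] power2_eq_square algebra_simps)
  qed
  have "v \<bullet> v = 0"
  proof (rule ccontr)
    assume "v \<bullet> v \<noteq> 0"
    then have vv: "v \<bullet> v > 0" by simp
    define k where "k = \<bar>c * (v \<bullet> v) - v \<bullet> f v\<bar> + 1"
    have k: "k > 0" "c * (v \<bullet> v) - v \<bullet> f v \<le> k" by (auto simp: k_def)
    define s where "s = (v \<bullet> v) / k"
    have "2 * s * (v \<bullet> v) \<le> s\<^sup>2 * k"
      using var[of s] k(2) mult_left_mono[OF k(2), of "s\<^sup>2"] by simp
    also have "\<dots> = s * (v \<bullet> v)"
      using k by (simp add: s_def power2_eq_square)
    finally have "s * (v \<bullet> v) \<le> 0" by simp
    moreover have "0 < s * (v \<bullet> v)" using vv k by (simp add: s_def)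
    ultimately show False by simp
  qed
  then have "f e = c *\<^sub>R e" by (simp add: v_def)
  with e1 that show ?thesis by blast
qed

text \<open>
  Spectral theorem by splitting off one eigenvector at a time: the orthogonal complement of an
  eigenvector of a self-adjoint map is again invariant, and its dimension is smaller.
\<close>

lemma self_adjoint_eigenbasis_subspace:
  fixes f :: "'a::euclidean_space \<Rightarrow> 'a"
  assumes lin: "linear f" and sym: "\<And>x y. x \<bullet> f y = f x \<bullet> y"
    and "subspace V" and "\<And>x. x \<in> V \<Longrightarrow> f x \<in> V"
  shows "\<exists>E \<subseteq> V. finite E \<and> pairwise orthogonal E \<and> (\<forall>e\<in>E. norm e = 1) \<and>
           V \<subseteq> span E \<and> (\<forall>e\<in>E. \<exists>c. f e = c *\<^sub>R e)"
  using assms(3,4)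
proof (induction "dim V" arbitrary: V rule: less_induct)
  case less
  show ?case
  proof (cases "V = {0}")
    case True
    then show ?thesis by (intro exI[of _ "{}"]) auto
  next
    case False
    obtain e c where e: "e \<in> V" "norm e = 1" "f e = c *\<^sub>R e"
      using self_adjoint_eigenvector_in_subspace[OF lin sym less.prems(1) False less.prems(2)]
      by blast
    have ee: "e \<bullet> e = 1" using e by (simp add: norm_eq_1)
    define W where "W = {x \<in> V. e \<bullet> x = 0}"
    have W: "subspace W"
      using less.prems(1) by (auto simp: W_def subspace_def inner_add_right)
    have dim: "dim W < dim V"
    proof -
      have "W \<subseteq> V" "e \<in> V" "e \<notin> W" using e ee by (auto simp: W_def)
      then have "span W \<subset> span V"
        using W less.prems(1) by (auto simp: span_eq_iff[THEN iffD2])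
      then show ?thesis by (rule dim_psubset)
    qed
    have "f x \<in> W" if "x \<in> W" for x
      using that less.prems(2) sym[of e x] e by (simp add: W_def)
    from less.hyps[OF dim W this] obtain E where E: "E \<subseteq> W" "finite E" "pairwise orthogonal E"
      "\<forall>e\<in>E. norm e = 1" "W \<subseteq> span E" "\<forall>e\<in>E. \<exists>c. f e = c *\<^sub>R e"
      by blast
    have "V \<subseteq> span (insert e E)"
    proof
      fix x assume x: "x \<in> V"
      have "x - (e \<bullet> x) *\<^sub>R e \<in> W"
        using x e ee less.prems(1) by (simp add: W_def subspace_diff subspace_scale inner_diff_right)
      then have "x - (e \<bullet> x) *\<^sub>R e \<in> span E" using E by blast
      then show "x \<in> span (insert e E)" by (auto simp: span_insert)
    qed
    moreover have "pairwise orthogonal (insert e E)"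
      using E(1,3) by (auto simp: pairwise_insert W_def orthogonal_def inner_commute)
    ultimately show ?thesis
      using E e by (intro exI[of _ "insert e E"]) (auto simp: W_def)
  qed
qed

lemma symmetric_matrix_inner:
  fixes M :: "real ^ 'n ^ 'n"
  assumes "transpose M = M"
  shows "x \<bullet> (M *v y) = (M *v x) \<bullet> y"
  by (metis assms dot_lmul_matrix transpose_matrix_vector)

lemma symmetric_matrix_eigenbasis:
  fixes M :: "real ^ 'n ^ 'n"
  assumes "transpose M = M"
  obtains E c where "finite E" "\<And>e. e \<in> E \<Longrightarrow> norm e = 1"
    "\<And>x. (\<Sum>e\<in>E. (x \<bullet> e) *\<^sub>R e) = x" "\<And>e. e \<in> E \<Longrightarrow> M *v e = c e *\<^sub>R e"
    "\<And>e e'. \<lbrakk>e \<in> E; e' \<in> E\<rbrakk> \<Longrightarrow> e \<bullet> e' = (if e = e' then 1 else 0)"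
proof -
  obtain E where E: "finite E" "pairwise orthogonal E" "\<forall>e\<in>E. norm e = 1" "UNIV \<subseteq> span E"
      "\<forall>e\<in>E. \<exists>c. M *v e = c *\<^sub>R e"
    using self_adjoint_eigenbasis_subspace[OF matrix_vector_mul_linear
      symmetric_matrix_inner[OF assms] subspace_UNIV] by auto
  then obtain c where ev: "\<And>e. e \<in> E \<Longrightarrow> M *v e = c e *\<^sub>R e" by metis
  have ex: "(\<Sum>e\<in>E. (x \<bullet> e) *\<^sub>R e) = x" for x
    using orthonormal_basis_expand[of E x] E by blast
  have on: "e \<bullet> e' = (if e = e' then 1 else 0)" if "e \<in> E" "e' \<in> E" for e e'
    using E that by (auto simp: pairwise_def orthogonal_def norm_eq_1)
  have "norm e = 1" if "e \<in> E" for e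
    using E that by simp
  from that[OF E(1) this ex ev on] show ?thesis .
qed

lemma symmetric_matrixI:
  fixes M :: "real ^ 'n ^ 'n"
  assumes "\<And>x y. x \<bullet> (M *v y) = (M *v x) \<bullet> y"
  shows "transpose M = M"
proof -
  have "y \<bullet> (transpose M *v x) = y \<bullet> (M *v x)" for x y
    by (metis assms dot_lmul_matrix inner_commute transpose_matrix_vector)
  then have "transpose M *v x = M *v x" for x
    using vector_eq_ldot by blast
  then show ?thesis by (simp add: matrix_eq)
qed

text \<open>
  The square root multiplies each vector of an orthonormal eigenbasis by the root of its
  eigenvalue.
\<close>

lemma pos_def_sqrt_exists:
  fixes M :: "real ^ 'n ^ 'n"
  assumes "pos_def M"
  shows "\<exists>S. pos_def S \<and> S ** S = M"
proof -
  obtain E c where E: "finite E" "\<And>e. e \<in> E \<Longrightarrow> norm e = 1"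
    and ex: "\<And>x. (\<Sum>e\<in>E. (x \<bullet> e) *\<^sub>R e) = x" and ev: "\<And>e. e \<in> E \<Longrightarrow> M *v e = c e *\<^sub>R e"
    and on: "\<And>e e'. \<lbrakk>e \<in> E; e' \<in> E\<rbrakk> \<Longrightarrow> e \<bullet> e' = (if e = e' then 1 else 0)"
    by (rule symmetric_matrix_eigenbasis[of M]) (use assms in \<open>auto simp: pos_def_def\<close>)
  have c: "c e > 0" if "e \<in> E" for e
  proof -
    have "e \<noteq> 0" using E(2)[OF that] by auto
    then have "0 < e \<bullet> (M *v e)" using assms by (simp add: pos_def_def)
    then show ?thesis using on[OF that that] by (simp add: ev[OF that])
  qed
  define f where "f = (\<lambda>x. \<Sum>e\<in>E. (sqrt (c e) * (x \<bullet> e)) *\<^sub>R e)"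
  have lin: "linear f"
    unfolding f_def
    by (intro linearI) (simp_all add: inner_add_left algebra_simps sum.distrib scaleR_sum_right)
  define S where "S = matrix f"
  have S: "S *v x = f x" for x
    using lin by (simp add: S_def matrix_works)
  have inner_f: "y \<bullet> f x = (\<Sum>e\<in>E. sqrt (c e) * (x \<bullet> e) * (y \<bullet> e))" for x y
    by (simp add: f_def inner_sum_right)
  have fe: "f e = sqrt (c e) *\<^sub>R e" if "e \<in> E" for e
  proof -
    have "f e = (\<Sum>e'\<in>E. if e' = e then sqrt (c e) *\<^sub>R e else 0)"
      unfolding f_def using on that by (intro sum.cong) auto
    then show ?thesis using E that by simp
  qed
  have "S ** S = M"
  proof (unfold matrix_eq, intro allI)
    fix x
    have "(S ** S) *v e = M *v e" if "e \<in> E" for e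
      using c[OF that] fe[OF that] linear_scale[OF lin, of "sqrt (c e)" e] ev[OF that]
      by (simp add: matrix_vector_mul_assoc[symmetric] S)
    then have "(S ** S) *v (\<Sum>e\<in>E. (x \<bullet> e) *\<^sub>R e) = M *v (\<Sum>e\<in>E. (x \<bullet> e) *\<^sub>R e)"
      by (simp add: linear_sum[OF matrix_vector_mul_linear] matrix_vector_mult_scaleR)
    then show "(S ** S) *v x = M *v x" by (simp only: ex)
  qed
  moreover have "transpose S = S"
  proof (rule symmetric_matrixI)
    show "x \<bullet> (S *v y) = (S *v x) \<bullet> y" for x y
      unfolding S inner_commute[of "f x" y] inner_f by (simp only: mult_ac)
  qed
  moreover have "0 < x \<bullet> (S *v x)" if "x \<noteq> 0" for x
  proof -
    have "\<exists>e\<in>E. x \<bullet> e \<noteq> 0"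
    proof (rule ccontr)
      assume "\<not> ?thesis"
      then have "(\<Sum>e\<in>E. (x \<bullet> e) *\<^sub>R e) = 0" by simp
      with that show False by (simp only: ex)
    qed
    then obtain e where "e \<in> E" "x \<bullet> e \<noteq> 0" by blast
    then have "0 < (\<Sum>e\<in>E. sqrt (c e) * (x \<bullet> e)\<^sup>2)"
      using E c by (intro sum_pos2[of E e]) (auto simp: less_imp_le)
    then show ?thesis unfolding S inner_f by (simp only: power2_eq_square mult.assoc)
  qed
  ultimately show ?thesis by (auto simp: pos_def_def)
qed

text \<open>
  If \<open>S\<^sup>2 = R\<^sup>2\<close>, an eigenvector \<open>e\<close> of the symmetric matrix \<open>S - R\<close> with eigenvalue \<open>c\<close> satisfies
  \<open>0 = c (e \<bullet> S e + e \<bullet> R e)\<close>, so that \<open>c = 0\<close>.  A basis of such eigenvectors forces \<open>S - R = 0\<close>.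
\<close>

lemma pos_def_sqrt_unique:
  fixes S R :: "real ^ 'n ^ 'n"
  assumes S: "pos_def S" and R: "pos_def R" and eq: "S ** S = R ** R"
  shows "S = R"
proof -
  have sym: "x \<bullet> (S *v y) = (S *v x) \<bullet> y" "x \<bullet> (R *v y) = (R *v x) \<bullet> y" for x y
    using S R by (auto intro: symmetric_matrix_inner simp: pos_def_def)
  have tr: "transpose (S - R) = S - R"
    by (rule symmetric_matrixI)
      (simp only: matrix_vector_mult_diff_rdistrib inner_diff_left inner_diff_right sym)
  obtain E c where E: "finite E" "\<And>e. e \<in> E \<Longrightarrow> norm e = 1"
    and ex: "\<And>x. (\<Sum>e\<in>E. (x \<bullet> e) *\<^sub>R e) = x" and ev: "\<And>e. e \<in> E \<Longrightarrow> (S - R) *v e = c e *\<^sub>R e"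
    by (rule symmetric_matrix_eigenbasis[OF tr]) blast
  have "(S - R) *v e = 0" if e: "e \<in> E" for e
  proof -
    have e0: "e \<noteq> 0" using E(2)[OF e] by auto
    have d: "S *v e - R *v e = c e *\<^sub>R e"
      using ev[OF e] by (simp add: matrix_vector_mult_diff_rdistrib)
    have "S *v (S *v e) = R *v (R *v e)"
      using eq by (simp add: matrix_vector_mul_assoc)
    \<comment> \<open>\<open>S (S - R) + (S - R) R = S\<^sup>2 - R\<^sup>2 = 0\<close>, tested on the eigenvector.\<close>
    then have "0 = e \<bullet> (S *v (S *v e - R *v e)) + (S *v e - R *v e) \<bullet> (R *v e)"
      by (simp add: matrix_vector_mult_diff_distrib inner_diff_left inner_diff_right sym)
    also have "\<dots> = c e * (e \<bullet> (S *v e) + e \<bullet> (R *v e))"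
      by (simp add: d matrix_vector_mult_scaleR algebra_simps)
    finally have "c e = 0"
      using add_pos_pos[of "e \<bullet> (S *v e)" "e \<bullet> (R *v e)"] S R e0
      by (simp only: pos_def_def) auto
    then show ?thesis using ev[OF e] by simp
  qed
  then have "(S - R) *v (\<Sum>e\<in>E. (x \<bullet> e) *\<^sub>R e) = 0" for x
    by (simp add: linear_sum[OF matrix_vector_mul_linear] matrix_vector_mult_scaleR)
  then have "(S - R) *v x = 0" for x
    by (simp only: ex)
  then show ?thesis
    by (simp add: matrix_eq matrix_vector_mult_diff_rdistrib)
qed

text \<open>
  Existence and uniqueness together make the definite description behind \<open>mat_sqrt\<close> meaningful.
\<close>

lemma mat_sqrt_pos_def:
  assumes "pos_def M"
  shows "pos_def (mat_sqrt M)" "mat_sqrt M ** mat_sqrt M = M"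
proof -
  have "\<exists>!S. pos_def S \<and> S ** S = M"
    using pos_def_sqrt_exists[OF assms] pos_def_sqrt_unique by blast
  from theI'[OF this] show "pos_def (mat_sqrt M)" "mat_sqrt M ** mat_sqrt M = M"
    unfolding mat_sqrt_def by auto
qed

lemma pos_def_invertible:
  fixes M :: "real ^ 'n ^ 'n"
  assumes "pos_def M"
  shows "invertible M"
proof -
  have "inj ((*v) M)"
    using assms by (intro linear_injective_0[OF matrix_vector_mul_linear, THEN iffD2])
      (auto simp: pos_def_def)
  then show ?thesis
    by (simp add: invertible_left_inverse matrix_left_invertible_injective)
qed

lemma matrix_inv_right: "invertible S \<Longrightarrow> S ** matrix_inv S = mat 1"
  unfolding matrix_inv_def invertible_def by (rule someI2_ex) auto

text \<open>
  Completing the square: with \<open>S = D\<^sup>1\<^sup>/\<^sup>2\<close> and \<open>z = S\<^sup>-\<^sup>1 b\<close> the difference of the two sides is half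
  the square length of \<open>S a - z\<close>.  Taking for \<open>a\<close> the gradient of the log-ratio of two densities,
  this removes that gradient from the entropy production and leaves only the drift mismatch \<open>b\<close>.
\<close>

lemma quadratic_bound_mat_inv_sqrt:
  fixes D :: "real ^ 'n ^ 'n"
  assumes "pos_def D"
  shows "a \<bullet> b - 1 / 2 * (a \<bullet> (D *v a)) \<le> 1 / 2 * (norm (mat_inv_sqrt D *v b))\<^sup>2"
proof -
  define S where "S = mat_sqrt D"
  have S: "pos_def S" "S ** S = D"
    using mat_sqrt_pos_def[OF assms] by (auto simp: S_def)
  define z where "z = mat_inv_sqrt D *v b"
  have "S ** matrix_inv S = mat 1"
    using pos_def_invertible[OF S(1)] by (rule matrix_inv_right)
  then have b: "b = S *v z"
    by (simp add: z_def mat_inv_sqrt_def S_def[symmetric] matrix_vector_mul_assoc)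
  have sym: "x \<bullet> (S *v y) = (S *v x) \<bullet> y" for x y
    using S by (auto intro: symmetric_matrix_inner simp: pos_def_def)
  have "a \<bullet> (D *v a) = (S *v a) \<bullet> (S *v a)"
    by (simp add: S(2)[symmetric] matrix_vector_mul_assoc[symmetric] sym)
  moreover have "a \<bullet> b = (S *v a) \<bullet> z"
    by (simp add: b sym)
  moreover have "0 \<le> (S *v a - z) \<bullet> (S *v a - z)" by simp
  ultimately show ?thesis
    by (simp add: z_def[symmetric] power2_norm_eq_inner inner_diff inner_commute)
qed


section \<open>Expectations under two densities and relative entropy\<close>

lemma pos_densityD:
  assumes "pos_density p"
  shows "0 < p x" "integrable lborel p" "(LINT x|lborel. p x) = 1" "p \<in> borel_measurable borel"
  using assms by (auto simp: pos_density_def has_bochner_integral_iff dest: borel_measurable_integrable)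

lemma prob_space_density_measure:
  assumes "pos_density p"
  shows "prob_space (density_measure p)"
proof
  note p = pos_densityD[OF assms]
  have "emeasure (density_measure p) (space (density_measure p)) = (\<integral>\<^sup>+x. ennreal (p x) \<partial>lborel)"
    using p by (simp add: emeasure_density)
  also have "\<dots> = ennreal 1"
    using p by (subst nn_integral_eq_integral) (auto simp: less_imp_le)
  finally show "emeasure (density_measure p) (space (density_measure p)) = 1" by simp
qed

lemma integral_density_measure:
  fixes f :: "'a::euclidean_space \<Rightarrow> real"
  assumes "pos_density p" "f \<in> borel_measurable borel"
  shows "(LINT x|density_measure p. f x) = (LINT x|lborel. p x * f x)"
    "integrable (density_measure p) f \<longleftrightarrow> integrable lborel (\<lambda>x. p x * f x)"
  using pos_densityD[OF assms(1)] assms(2)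
  by (simp_all add: integral_real_density integrable_real_density less_imp_le)

lemma gibbs_pointwise:
  fixes p q a :: real
  assumes "p > 0" "q > 0"
  shows "p * a + p - q * exp a \<le> p * ln (p / q)"
proof -
  have "1 + (a - ln (p / q)) \<le> exp (a - ln (p / q))"
    by (rule exp_ge_add_one_self)
  also have "\<dots> = exp a * q / p"
    using assms by (simp add: exp_diff)
  finally have "p * (1 + (a - ln (p / q))) \<le> p * (exp a * q / p)"
    using assms by (intro mult_left_mono) auto
  then show ?thesis using assms by (simp add: algebra_simps)
qed

text \<open>
  The easy half of the Donsker-Varadhan formula: integrate the convexity inequality
  \<open>p a + p - q e\<^sup>a \<le> p ln (p / q)\<close>, whose left side has integral at least \<open>\<integral> p a\<close> once
  \<open>\<integral> q e\<^sup>a \<le> 1\<close>.  With \<open>a = 0\<close> it says that relative entropy is nonnegative.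
\<close>

lemma gibbs_variational_inequality:
  fixes p q a :: "'a::euclidean_space \<Rightarrow> real"
  assumes p: "pos_density p" and q: "pos_density q" and fin: "finite_rel_entropy p q"
    and pa: "integrable lborel (\<lambda>x. p x * a x)"
    and qe: "integrable lborel (\<lambda>x. q x * exp (a x))" "(LINT x|lborel. q x * exp (a x)) \<le> 1"
  shows "(LINT x|lborel. p x * a x) \<le> rel_entropy p q"
proof -
  note p = pos_densityD[OF p] and q = pos_densityD[OF q]
  have "(LINT x|lborel. p x * a x + p x - q x * exp (a x)) \<le> rel_entropy p q"
    unfolding rel_entropy_def using p q pa qe fin
    by (intro integral_mono gibbs_pointwise) (auto simp: finite_rel_entropy_def)
  moreover have "(LINT x|lborel. p x * a x + p x - q x * exp (a x))
      = (LINT x|lborel. p x * a x) + 1 - (LINT x|lborel. q x * exp (a x))"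
    using p q pa qe by simp
  ultimately show ?thesis using qe(2) by linarith
qed

lemma integrable_density_times_bounded:
  fixes f :: "'a::euclidean_space \<Rightarrow> real"
  assumes "pos_density p" "f \<in> borel_measurable borel" "\<And>x. \<bar>f x\<bar> \<le> b"
  shows "integrable lborel (\<lambda>x. p x * f x)"
proof (rule Bochner_Integration.integrable_bound)
  note p = pos_densityD[OF assms(1)]
  show "integrable lborel (\<lambda>x. b * p x)" using p by simp
  show "(\<lambda>x. p x * f x) \<in> borel_measurable lborel" using p(4) assms(2) by simp
  show "AE x in lborel. norm (p x * f x) \<le> norm (b * p x)"
    using assms(3) p(1)
    by (auto intro!: AE_I2 mult_mono simp: abs_mult less_imp_le mult.commute[of b] intro: order_trans[OF _ abs_ge_self])
qed

text \<open>
  Pinsker's inequality in dual form.  The variational inequality is tested with \<open>a = l (g - m) - k\<close>,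
  where \<open>m\<close> is the mean of \<open>g\<close> under \<open>q\<close>; by Hoeffding's lemma \<open>k = l\<^sup>2 (hi - lo)\<^sup>2 / 8\<close> is enough to
  make \<open>\<integral> q e\<^sup>a \<le> 1\<close>.  Optimising the resulting quadratic inequality over \<open>l > 0\<close> gives the sharp
  constant \<open>1 / \<surd>2\<close>.
\<close>

lemma expectation_diff_le_rel_entropy:
  fixes g :: "'a::euclidean_space \<Rightarrow> real"
  assumes p: "pos_density p" and q: "pos_density q" and fin: "finite_rel_entropy p q"
    and g: "g \<in> borel_measurable borel" and bounds: "\<And>x. lo \<le> g x" "\<And>x. g x \<le> hi"
  shows "(LINT x|density_measure p. g x) - (LINT x|density_measure q. g x)
           \<le> (hi - lo) / sqrt 2 * sqrt (rel_entropy p q)"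
proof -
  note pd = pos_densityD[OF p] and qd = pos_densityD[OF q]
  interpret prob_space "density_measure q"
    using q by (rule prob_space_density_measure)
  interpret interval_bounded_random_variable "density_measure q" g lo hi
    by unfold_locales (use g bounds in auto)
  define m where "m = (LINT x|density_measure q. g x)"
  define \<Delta> where "\<Delta> = (LINT x|density_measure p. g x) - m"
  define R where "R = rel_entropy p q"
  define w where "w = hi - lo"
  have "lo \<le> hi" using bounds order_trans by blast
  then have w: "0 \<le> w" by (simp add: w_def)
  have bdd: "\<bar>g x\<bar> \<le> \<bar>lo\<bar> + \<bar>hi\<bar>" for x
    using bounds[of x] by linarith
  have pg: "integrable lborel (\<lambda>x. p x * g x)"
    using integrable_density_times_bounded[OF p g bdd] .
  have quad: "l * \<Delta> \<le> R + l\<^sup>2 * w\<^sup>2 / 8" if l: "l > 0" for l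
  proof -
    define k where "k = l\<^sup>2 * w\<^sup>2 / 8"
    define a where "a = (\<lambda>x. l * (g x - m) - k)"
    have "(\<integral>\<^sup>+x. ennreal (exp (l * (g x - m))) \<partial>density_measure q) \<le> ennreal (exp k)"
      using Hoeffdings_lemma_nn_integral[OF l] by (simp add: k_def m_def w_def)
    then have H: "(\<integral>\<^sup>+x. ennreal (q x * exp (l * (g x - m))) \<partial>lborel) \<le> ennreal (exp k)"
      using qd g by (simp add: nn_integral_density ennreal_mult less_imp_le)
    have int: "integrable lborel (\<lambda>x. q x * exp (l * (g x - m)))"
    proof (rule integrableI_bounded)
      show "(\<lambda>x. q x * exp (l * (g x - m))) \<in> borel_measurable lborel" using qd(4) g by simp
      show "(\<integral>\<^sup>+x. ennreal (norm (q x * exp (l * (g x - m)))) \<partial>lborel) < \<infinity>"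
        using H qd(1) by (simp add: abs_mult less_imp_le) (meson ennreal_less_top order_le_less_trans)
    qed
    have "(LINT x|lborel. q x * exp (l * (g x - m))) \<le> exp k"
      using H int qd(1) by (subst (asm) nn_integral_eq_integral) (auto simp: less_imp_le)
    moreover have "q x * exp (a x) = (q x * exp (l * (g x - m))) / exp k" for x
      by (simp add: a_def exp_diff)
    ultimately have "(LINT x|lborel. q x * exp (a x)) \<le> 1" "integrable lborel (\<lambda>x. q x * exp (a x))"
      using int by simp_all
    moreover have pa: "p x * a x = l * (p x * g x) - (l * m + k) * p x" for x
      by (simp add: a_def algebra_simps)
    moreover have "integrable lborel (\<lambda>x. p x * a x)"
      unfolding pa using pg pd by simp
    ultimately have "(LINT x|lborel. p x * a x) \<le> R"
      unfolding R_def using gibbs_variational_inequality[OF p q fin] by blast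
    moreover have "(LINT x|lborel. p x * a x) = l * \<Delta> - k"
      unfolding pa using pg pd by (simp add: \<Delta>_def integral_density_measure[OF p g] algebra_simps)
    ultimately show ?thesis by (simp add: k_def)
  qed
  have R: "0 \<le> R"
    using gibbs_variational_inequality[OF p q fin, of "\<lambda>_. 0"] qd by (simp add: R_def)
  have "\<Delta> \<le> w / sqrt 2 * sqrt R"
  proof (cases "\<Delta> \<le> 0")
    case True
    also have "0 \<le> w / sqrt 2 * sqrt R" using w R by simp
    finally show ?thesis .
  next
    case False
    then have \<Delta>: "\<Delta> > 0" by simp
    have "w > 0"
    proof (rule ccontr)
      assume "\<not> 0 < w"
      then have "w = 0" using w by simp
      then show False using quad[of "(R + 1) / \<Delta>"] \<Delta> R by simp
    qed
    \<comment> \<open>This \<open>l\<close> minimises \<open>l\<^sup>2 w\<^sup>2 / 8 - l \<Delta>\<close>.\<close>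
    then have "2 * \<Delta>\<^sup>2 \<le> R * w\<^sup>2"
      using quad[of "4 * \<Delta> / w\<^sup>2"] \<Delta> by (simp add: divide_simps power2_eq_square algebra_simps)
    then have "\<Delta> \<le> sqrt (R * w\<^sup>2 / 2)"
      by (intro real_le_rsqrt) simp
    also have "\<dots> = w / sqrt 2 * sqrt R"
      using w by (simp add: real_sqrt_mult real_sqrt_divide)
    finally show ?thesis .
  qed
  then show ?thesis by (simp add: \<Delta>_def m_def w_def R_def)
qed


section \<open>Gradients and divergences\<close>

lemma GDERIV_grad:
  fixes f :: "real ^ 'n \<Rightarrow> real"
  assumes "f differentiable (at x)"
  shows "GDERIV f x :> grad f x"
proof -
  have D: "(f has_derivative frechet_derivative f (at x)) (at x)"
    using assms by (simp add: frechet_derivative_works)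
  have "frechet_derivative f (at x) h = h \<bullet> grad f x" for h
  proof -
    have "frechet_derivative f (at x) h = frechet_derivative f (at x) (\<Sum>i\<in>UNIV. (h $ i) *\<^sub>R axis i 1)"
      by (simp add: basis_expansion scalar_mult_eq_scaleR[symmetric])
    then show ?thesis
      using has_derivative_linear[OF D]
      by (simp add: linear_sum linear_scale grad_def inner_vec_def)
  qed
  then have "frechet_derivative f (at x) = (\<lambda>h. h \<bullet> grad f x)" by auto
  with D show ?thesis by (simp add: gderiv_def)
qed

lemma grad_eqI:
  fixes f :: "real ^ 'n \<Rightarrow> real"
  assumes "GDERIV f x :> v"
  shows "grad f x = v"
proof -
  have "(\<lambda>h. h \<bullet> v) = frechet_derivative f (at x)"
    using assms unfolding gderiv_def by (rule frechet_derivative_at)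
  then show ?thesis
    by (simp add: grad_def vec_eq_iff inner_axis' fun_eq_iff[symmetric] flip: \<open>_ = frechet_derivative f (at x)\<close>)
qed

lemma divergence_has_derivative:
  assumes "(F has_derivative F') (at x)"
  shows "divergence F x = (\<Sum>i\<in>UNIV. F' (axis i 1) $ i)"
  by (simp add: divergence_def trace_def jacobian_def matrix_def frechet_derivative_at[OF assms, symmetric])

lemma divergence_scaleR:
  fixes h :: "real ^ 'n \<Rightarrow> real"
  assumes h: "h differentiable (at x)" and J: "J differentiable (at x)"
  shows "divergence (\<lambda>y. h y *\<^sub>R J y) x = h x * divergence J x + grad h x \<bullet> J x"
proof -
  obtain J' where J': "(J has_derivative J') (at x)"
    using J by (auto simp: differentiable_def)
  have h': "(h has_derivative (\<lambda>v. v \<bullet> grad h x)) (at x)"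
    using GDERIV_grad[OF h] by (simp add: gderiv_def)
  have "((\<lambda>y. h y *\<^sub>R J y) has_derivative (\<lambda>v. h x *\<^sub>R J' v + (v \<bullet> grad h x) *\<^sub>R J x)) (at x)"
    by (rule has_derivative_scaleR[OF h' J'])
  from divergence_has_derivative[OF this] show ?thesis
    by (simp add: divergence_has_derivative[OF J'] sum.distrib sum_distrib_left inner_axis'
        inner_vec_def[of "grad h x" "J x"])
qed

lemma divergence_lincomb:
  assumes F: "F differentiable (at x)" and H: "H differentiable (at x)"
  shows "(\<lambda>y. a *\<^sub>R F y + c *\<^sub>R H y) differentiable (at x)"
    and "divergence (\<lambda>y. a *\<^sub>R F y + c *\<^sub>R H y) x = a * divergence F x + c * divergence H x"
proof -
  obtain F' H' where *: "(F has_derivative F') (at x)" "(H has_derivative H') (at x)"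
    using F H by (auto simp: differentiable_def)
  then have D: "((\<lambda>y. a *\<^sub>R F y + c *\<^sub>R H y) has_derivative (\<lambda>v. a *\<^sub>R F' v + c *\<^sub>R H' v)) (at x)"
    by (intro derivative_intros)
  then show "(\<lambda>y. a *\<^sub>R F y + c *\<^sub>R H y) differentiable (at x)"
    by (rule differentiableI)
  from divergence_has_derivative[OF D]
  show "divergence (\<lambda>y. a *\<^sub>R F y + c *\<^sub>R H y) x = a * divergence F x + c * divergence H x"
    by (simp add: divergence_has_derivative[OF *(1)] divergence_has_derivative[OF *(2)]
        sum.distrib sum_distrib_left)
qed

section \<open>The entropy balance of two Fokker-Planck equations\<close>

lemma fokker_planck_flux:
  assumes FP: "fokker_planck T b D p" and t: "t \<in> T"
  shows "p t differentiable (at x)"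
    and "fp_flux (b t) D (p t) differentiable (at x)"
    and "((\<lambda>s. p s x) has_real_derivative divergence (fp_flux (b t) D (p t)) x) (at t)"
proof -
  from FP t have p: "p t differentiable (at x)" "grad (p t) differentiable (at x)"
    "(\<lambda>y. p t y *\<^sub>R b t y) differentiable (at x)"
    and eq: "((\<lambda>s. p s x) has_real_derivative
        (- divergence (\<lambda>y. p t y *\<^sub>R b t y) x + 1 / 2 * divergence (\<lambda>y. D *v grad (p t) y) x)) (at t)"
    unfolding fokker_planck_def by blast+
  have Dp: "(\<lambda>y. D *v grad (p t) y) differentiable (at x)"
    using differentiable_chain_at[OF p(2) linear_imp_differentiable[OF matrix_vector_mul_linear[of D]]]
    by (simp add: o_def)
  have flux: "fp_flux (b t) D (p t)
      = (\<lambda>y. (- 1) *\<^sub>R (p t y *\<^sub>R b t y) + (1 / 2) *\<^sub>R (D *v grad (p t) y))"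
    by (simp add: fp_flux_def fun_eq_iff)
  show "p t differentiable (at x)" by fact
  show "fp_flux (b t) D (p t) differentiable (at x)"
    unfolding flux by (rule divergence_lincomb(1)[OF p(3) Dp])
  show "((\<lambda>s. p s x) has_real_derivative divergence (fp_flux (b t) D (p t)) x) (at t)"
    unfolding flux divergence_lincomb(2)[OF p(3) Dp] using eq by simp
qed

text \<open>
  The hypothesis speaks about the divergence of the product; the product rule turns it into the
  form in which a derivative is moved from \<open>J\<close> to \<open>h\<close>.
\<close>

lemma integration_by_parts_no_boundary:
  fixes h :: "real ^ 'n \<Rightarrow> real"
  assumes nb: "no_boundary_term h J"
    and h: "\<And>x. h differentiable (at x)" and J: "\<And>x. J differentiable (at x)"
  shows "(LINT x|lborel. h x * divergence J x) = - (LINT x|lborel. grad h x \<bullet> J x)"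
proof -
  have "(LINT x|lborel. h x * divergence J x + grad h x \<bullet> J x) = 0"
    using nb by (simp add: no_boundary_term_def divergence_scaleR[OF h J])
  then show ?thesis
    using nb by (simp add: no_boundary_term_def)
qed

lemma GDERIV_ratio:
  fixes p q :: "real ^ 'n \<Rightarrow> real"
  assumes "p differentiable (at x)" "q differentiable (at x)" "p x > 0" "q x > 0"
  defines "a \<equiv> grad p x /\<^sub>R p x - grad q x /\<^sub>R q x"
  shows "GDERIV (\<lambda>y. ln (p y / q y)) x :> a"
    and "GDERIV (\<lambda>y. p y / q y) x :> (p x / q x) *\<^sub>R a"
proof -
  have p: "(p has_derivative (\<lambda>v. v \<bullet> grad p x)) (at x)"
    and q: "(q has_derivative (\<lambda>v. v \<bullet> grad q x)) (at x)"
    using GDERIV_grad assms(1,2) by (auto simp: gderiv_def)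
  show r: "GDERIV (\<lambda>y. p y / q y) x :> (p x / q x) *\<^sub>R a"
    unfolding gderiv_def a_def using assms(3,4)
    by (auto intro!: derivative_eq_intros p q simp: fun_eq_iff field_simps inner_diff_right)
  have "GDERIV (\<lambda>y. ln (p y / q y)) x :> inverse (p x / q x) *\<^sub>R ((p x / q x) *\<^sub>R a)"
    using assms(3,4) by (intro GDERIV_DERIV_compose[OF r] DERIV_ln) simp
  then show "GDERIV (\<lambda>y. ln (p y / q y)) x :> a"
    using assms(3,4) by simp
qed

lemma differentiable_GDERIV: "GDERIV f x :> v \<Longrightarrow> f differentiable (at x)"
  by (auto simp: gderiv_def differentiable_def)

text \<open>
  The fluxes are arranged so that \<open>fp_flux b D p - (p / q) fp_flux c D q\<close> equals
  \<open>- p (b - c) + p D a / 2\<close>, where \<open>a\<close> is the gradient of \<open>ln (p / q)\<close>: the parts of the two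
  fluxes that do not involve the drift mismatch or \<open>a\<close> cancel.
\<close>

lemma entropy_production_integrand:
  fixes p q :: "real ^ 'n \<Rightarrow> real"
  assumes "p differentiable (at x)" "q differentiable (at x)" "p x > 0" "q x > 0"
  defines "a \<equiv> grad (\<lambda>y. ln (p y / q y)) x"
  shows "grad (\<lambda>y. p y / q y) x \<bullet> fp_flux c D q x - a \<bullet> fp_flux b D p x
    = p x * (a \<bullet> (b x - c x) - 1 / 2 * (a \<bullet> (D *v a)))"
proof -
  have a: "a = grad p x /\<^sub>R p x - grad q x /\<^sub>R q x"
    unfolding a_def by (rule grad_eqI[OF GDERIV_ratio(1)[OF assms(1-4)]])
  have r: "grad (\<lambda>y. p y / q y) x = (p x / q x) *\<^sub>R a"
    unfolding a by (rule grad_eqI[OF GDERIV_ratio(2)[OF assms(1-4)]])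
  have "D *v a = (D *v grad p x) /\<^sub>R p x - (D *v grad q x) /\<^sub>R q x"
    by (simp add: a matrix_vector_mult_diff_distrib matrix_vector_mult_scaleR)
  then have Da: "a \<bullet> (D *v a) = (a \<bullet> (D *v grad p x)) / p x - (a \<bullet> (D *v grad q x)) / q x"
    by (simp add: inner_diff_right divide_inverse_commute)
  show ?thesis
    unfolding r Da fp_flux_def using assms(3,4)
    by (simp add: inner_diff_right inner_add_right field_simps)
qed

lemma DERIV_entropy_integrand:
  assumes "(f has_real_derivative f') (at t)" "(g has_real_derivative g') (at t)" "f t > 0" "g t > 0"
  shows "((\<lambda>s. f s * ln (f s / g s)) has_real_derivative
    (ln (f t / g t) * f' + f' - f t / g t * g')) (at t)"
proof -
  have "((\<lambda>s. f s * ln (f s / g s)) has_real_derivative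
      f' * ln (f t / g t) + (1 / (f t / g t) * ((f' * g t - f t * g') / (g t * g t))) * f t) (at t)"
    using assms by (intro DERIV_mult DERIV_chain2[of ln] DERIV_ln_divide DERIV_divide) auto
  then show ?thesis
    by (rule DERIV_cong) (use assms in \<open>simp add: field_simps\<close>)
qed

text \<open>
  Entropy balance.  By the two Fokker-Planck equations the time derivative of \<open>p ln (p / q)\<close> is
  \<open>ln (p / q) div J + div J - (p / q) div K\<close> with the fluxes \<open>J\<close> and \<open>K\<close>.  The middle term is the
  time derivative of \<open>p\<close> and integrates to zero because mass is conserved; the other two are
  integrated by parts.
\<close>

lemma rel_entropy_has_derivative:
  fixes p q :: "real \<Rightarrow> real ^ 'n \<Rightarrow> real"
  assumes T: "open T" "t \<in> T"
    and dens: "\<And>s. s \<in> T \<Longrightarrow> pos_density (p s)" "pos_density (q t)"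
    and FP: "fokker_planck T b D p" "fokker_planck T c D q"
    and de: "diff_under_integral (\<lambda>s x. p s x * ln (p s x / q s x)) t"
    and dm: "diff_under_integral p t"
    and nb: "no_boundary_term (\<lambda>x. ln (p t x / q t x)) (fp_flux (b t) D (p t))"
      "no_boundary_term (\<lambda>x. p t x / q t x) (fp_flux (c t) D (q t))"
  defines "a \<equiv> grad (\<lambda>y. ln (p t y / q t y))"
  defines "I \<equiv> \<lambda>x. p t x * (a x \<bullet> (b t x - c t x) - 1 / 2 * (a x \<bullet> (D *v a x)))"
  shows "integrable lborel I"
    and "((\<lambda>s. rel_entropy (p s) (q s)) has_real_derivative (LINT x|lborel. I x)) (at t)"
proof -
  note p = pos_densityD[OF dens(1)[OF T(2)]] and q = pos_densityD[OF dens(2)]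
  note fp = fokker_planck_flux[OF FP(1) T(2)] and fq = fokker_planck_flux[OF FP(2) T(2)]
  define J K where "J = fp_flux (b t) D (p t)" and "K = fp_flux (c t) D (q t)"
  define h r where "h = (\<lambda>x. ln (p t x / q t x))" and "r = (\<lambda>x. p t x / q t x)"
  have diff: "h differentiable (at x)" "r differentiable (at x)" for x
    using GDERIV_ratio[OF fp(1) fq(1) p(1) q(1), of x] by (auto simp: h_def r_def differentiable_GDERIV)
  note nb = nb[folded J_def K_def, folded h_def r_def]
  have I: "I = (\<lambda>x. grad r x \<bullet> K x - grad h x \<bullet> J x)"
    using entropy_production_integrand[OF fp(1) fq(1) p(1) q(1)]
    by (simp add: I_def a_def h_def r_def J_def K_def)
  show "integrable lborel I"
    using nb by (simp add: I no_boundary_term_def)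
  have ddt: "deriv (\<lambda>s. p s x * ln (p s x / q s x)) t
      = h x * divergence J x + divergence J x - r x * divergence K x" for x
    unfolding h_def r_def J_def K_def
    by (rule DERIV_imp_deriv[OF DERIV_entropy_integrand[OF fp(3) fq(3) p(1) q(1)]])
  have mass: "deriv (\<lambda>s. p s x) t = divergence J x" for x
    unfolding J_def by (rule DERIV_imp_deriv[OF fp(3)])
  \<comment> \<open>The mass is constant near \<open>t\<close> because \<open>T\<close> is open.\<close>
  have "((\<lambda>s. 1) has_real_derivative (LINT x|lborel. divergence J x)) (at t)"
  proof (rule has_field_derivative_transform_within_open[OF _ T])
    show "((\<lambda>s. LINT x|lborel. p s x) has_real_derivative (LINT x|lborel. divergence J x)) (at t)"
      using dm by (simp only: diff_under_integral_def mass)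
    show "(LINT x|lborel. p s x) = 1" if "s \<in> T" for s
      by (rule pos_densityD(3)[OF dens(1)[OF that]])
  qed
  then have mass0: "(LINT x|lborel. divergence J x) = 0"
    by (rule DERIV_unique) simp
  have massi: "integrable lborel (divergence J)"
    using dm by (simp add: diff_under_integral_def mass)
  have "(LINT x|lborel. h x * divergence J x + divergence J x - r x * divergence K x)
      = (LINT x|lborel. h x * divergence J x) - (LINT x|lborel. r x * divergence K x)"
    using nb massi mass0 by (simp add: no_boundary_term_def)
  also have "\<dots> = (LINT x|lborel. I x)"
  proof -
    have "(LINT x|lborel. I x) = (LINT x|lborel. grad r x \<bullet> K x) - (LINT x|lborel. grad h x \<bullet> J x)"
      unfolding I using nb by (intro Bochner_Integration.integral_diff) (simp_all add: no_boundary_term_def)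
    moreover have "(LINT x|lborel. h x * divergence J x) = - (LINT x|lborel. grad h x \<bullet> J x)"
      unfolding J_def by (rule integration_by_parts_no_boundary[OF nb(1)[unfolded J_def] diff(1) fp(2)])
    moreover have "(LINT x|lborel. r x * divergence K x) = - (LINT x|lborel. grad r x \<bullet> K x)"
      unfolding K_def by (rule integration_by_parts_no_boundary[OF nb(2)[unfolded K_def] diff(2) fq(2)])
    ultimately show ?thesis by simp
  qed
  finally show "((\<lambda>s. rel_entropy (p s) (q s)) has_real_derivative (LINT x|lborel. I x)) (at t)"
    using de by (simp add: diff_under_integral_def ddt rel_entropy_def)
qed

text \<open>
  The drift is the quotient of the differentiable functions \<open>p b\<close> and \<open>p\<close>.  Continuity is
  needed to see that \<open>g\<close> in the entropy bound is measurable.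
\<close>

lemma fokker_planck_drift_continuous:
  assumes FP: "fokker_planck T b D p" and t: "t \<in> T" and p: "\<And>x. p t x > 0"
  shows "continuous_on UNIV (b t)"
proof -
  have "p t differentiable (at x)" "(\<lambda>y. p t y *\<^sub>R b t y) differentiable (at x)" for x
    using FP t unfolding fokker_planck_def by blast+
  then have "continuous_on UNIV (p t)" "continuous_on UNIV (\<lambda>y. p t y *\<^sub>R b t y)"
    by (simp_all add: differentiable_imp_continuous_on differentiable_on_def)
  moreover have p0: "p t y \<noteq> 0" for y
    using p[of y] by simp
  ultimately have "continuous_on UNIV (\<lambda>y. (p t y *\<^sub>R b t y) /\<^sub>R p t y)"
    by (intro continuous_on_scaleR[OF continuous_on_inverse]) simp_all
  moreover have "(\<lambda>y. (p t y *\<^sub>R b t y) /\<^sub>R p t y) = b t"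
    using p0 by (simp add: fun_eq_iff)
  ultimately show ?thesis by (simp only:)
qed


section \<open>The entropy bound\<close>

theorem mainTheorem5:
  fixes T :: "real set"
    and U :: "real ^ 'd \<Rightarrow> 'th \<Rightarrow> real"
    and \<theta> \<theta>hat :: 'th
    and B :: "real ^ 'm ^ ('d + 'd)"
    and u :: "real \<Rightarrow> real ^ 'm"
    and G :: "real ^ 'q ^ ('d + 'd)"
    and Q :: "real ^ 'q ^ 'q"
    and D :: "real ^ ('d + 'd) ^ ('d + 'd)"
    and \<pi> \<pi>hat :: "real \<Rightarrow> real ^ ('d + 'd) \<Rightarrow> real"
    and \<mu> :: "real \<Rightarrow> real ^ ('d + 'd)"
    and \<phi> fhat :: "real \<Rightarrow> real ^ ('d + 'd) \<Rightarrow> real ^ ('d + 'd)"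
    and g :: "real \<Rightarrow> real ^ ('d + 'd) \<Rightarrow> real"
    and g_lo g_hi :: "real \<Rightarrow> real"
  assumes T_open: "open T"
    and Q_covariance: "pos_semidef Q"
    and D_eq: "D = G ** Q ** transpose G"
    and D_pos_def: "pos_def D"
    and U_differentiable:
      "\<And>\<eta> r. \<eta> \<in> {\<theta>, \<theta>hat} \<Longrightarrow> (\<lambda>s. U s \<eta>) differentiable (at r)"
    and density: "\<And>t. t \<in> T \<Longrightarrow> pos_density (\<pi> t)"
    and density_hat: "\<And>t. t \<in> T \<Longrightarrow> pos_density (\<pi>hat t)"
    and mean_exists: "\<And>t. t \<in> T \<Longrightarrow> integrable (density_measure (\<pi>hat t)) (\<lambda>x. x)"
    and mean_eq: "\<And>t. t \<in> T \<Longrightarrow> \<mu> t = (LINT x|density_measure (\<pi>hat t). x)"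
    and linearizable:
      "\<And>t. t \<in> T \<Longrightarrow> (\<lambda>x. drift U B \<theta>hat x (u t)) differentiable (at (\<mu> t))"
    and phi_eq: "\<phi> = (\<lambda>t x. drift U B \<theta> x (u t))"
    and fhat_eq: "fhat = (\<lambda>t x. affine_drift (drift U B \<theta>hat) B (\<mu> t) x (u t))"
    and FP: "fokker_planck T \<phi> D \<pi>"
    and FP_hat: "fokker_planck T fhat D \<pi>hat"
    and entropy_finite: "\<And>t. t \<in> T \<Longrightarrow> finite_rel_entropy (\<pi> t) (\<pi>hat t)"
    and diff_entropy:
      "\<And>t. t \<in> T \<Longrightarrow> diff_under_integral (\<lambda>s x. \<pi> s x * ln (\<pi> s x / \<pi>hat s x)) t"
    and diff_mass: "\<And>t. t \<in> T \<Longrightarrow> diff_under_integral \<pi> t"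
    and div_thm:
      "\<And>t. t \<in> T \<Longrightarrow> no_boundary_term (\<lambda>x. ln (\<pi> t x / \<pi>hat t x)) (fp_flux (\<phi> t) D (\<pi> t))"
    and div_thm_hat:
      "\<And>t. t \<in> T \<Longrightarrow> no_boundary_term (\<lambda>x. \<pi> t x / \<pi>hat t x) (fp_flux (fhat t) D (\<pi>hat t))"
    and g_eq: "g = (\<lambda>t x. (norm (mat_inv_sqrt D *v (\<phi> t x - fhat t x)))\<^sup>2)"
    and g_bounds: "\<And>t x. t \<in> T \<Longrightarrow> g_lo t \<le> g t x \<and> g t x \<le> g_hi t"
  shows "\<forall>t\<in>T. \<exists>R'.
    ((\<lambda>s. rel_entropy (\<pi> s) (\<pi>hat s)) has_real_derivative R') (at t) \<and>
    R' \<le> 1 / 2 * ((LINT x|density_measure (\<pi>hat t). g t x)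
             + (g_hi t - g_lo t) / sqrt 2 * sqrt (rel_entropy (\<pi> t) (\<pi>hat t)))"
proof (intro ballI exI conjI)
  fix t assume t: "t \<in> T"
  let ?a = "grad (\<lambda>y. ln (\<pi> t y / \<pi>hat t y))"
  let ?I = "\<lambda>x. \<pi> t x * (?a x \<bullet> (\<phi> t x - fhat t x) - 1 / 2 * (?a x \<bullet> (D *v ?a x)))"
  note p = pos_densityD[OF density[OF t]] and q = pos_densityD[OF density_hat[OF t]]
  note balance = rel_entropy_has_derivative[OF T_open t density density_hat[OF t] FP FP_hat
      diff_entropy[OF t] diff_mass[OF t] div_thm[OF t] div_thm_hat[OF t]]
  show "((\<lambda>s. rel_entropy (\<pi> s) (\<pi>hat s)) has_real_derivative (LINT x|lborel. ?I x)) (at t)"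
    by (rule balance(2))
  have "continuous_on UNIV (\<phi> t)" "continuous_on UNIV (fhat t)"
    using fokker_planck_drift_continuous[of T \<phi> D \<pi> t, OF FP t p(1)]
      fokker_planck_drift_continuous[of T fhat D \<pi>hat t, OF FP_hat t q(1)] by simp_all
  then have "continuous_on UNIV (\<lambda>x. mat_inv_sqrt D *v (\<phi> t x - fhat t x))"
    by (intro linear_continuous_on_compose[OF _ matrix_vector_mul_linear] continuous_on_diff)
  then have "continuous_on UNIV (g t)"
    unfolding g_eq by (intro continuous_on_power continuous_on_norm)
  then have g: "g t \<in> borel_measurable borel"
    by (rule borel_measurable_continuous_onI)
  have "\<bar>g t x\<bar> \<le> \<bar>g_lo t\<bar> + \<bar>g_hi t\<bar>" for x
    using g_bounds[OF t, of x] by linarith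
  from integrable_density_times_bounded[OF density[OF t] g this]
  have pg: "integrable lborel (\<lambda>x. \<pi> t x * g t x)" .
  have "?I x \<le> 1 / 2 * (\<pi> t x * g t x)" for x
    using mult_left_mono[OF quadratic_bound_mat_inv_sqrt[OF D_pos_def] less_imp_le[OF p(1)]]
    by (simp add: g_eq)
  then have "(LINT x|lborel. ?I x) \<le> (LINT x|lborel. 1 / 2 * (\<pi> t x * g t x))"
    by (intro integral_mono balance(1) integrable_mult_right pg)
  also have "\<dots> = 1 / 2 * (LINT x|density_measure (\<pi> t). g t x)"
    by (simp only: integral_mult_right_zero integral_density_measure(1)[OF density[OF t] g])
  also have "\<dots> \<le> 1 / 2 * ((LINT x|density_measure (\<pi>hat t). g t x)
      + (g_hi t - g_lo t) / sqrt 2 * sqrt (rel_entropy (\<pi> t) (\<pi>hat t)))"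
    using expectation_diff_le_rel_entropy[OF density[OF t] density_hat[OF t] entropy_finite[OF t] g,
        of "g_lo t" "g_hi t"] g_bounds[OF t] by simp
  finally show "(LINT x|lborel. ?I x) \<le> 1 / 2 * ((LINT x|density_measure (\<pi>hat t). g t x)
      + (g_hi t - g_lo t) / sqrt 2 * sqrt (rel_entropy (\<pi> t) (\<pi>hat t)))" .
qed

end
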